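(* Let $G$ be a group with a $BN$-pair $(B,N)$ and a finite Weyl group $W=N/H$, where $H=B\cap N$, and let $w_0$ be the unique longest element of $W$. Let $n_{0}\in N$ be such that $n_{0}H=w_{0}$. Then $G=(Bn_{0}B)^{2}=BB^{n_{0}}B$.
   Context: $G$ need not be finite. $G$ is a group with a $BN$-pair if there exist subgroups $B$ and $N$ of $G$ such that: (i) $G=\langle B,N\rangle$; (ii) $H:=B\cap N\trianglelefteq N$; (iii) $W:=N/H$ (the Weyl group of the $BN$-pair) is generated by a set of elements $s_{i}$, $i\in I$, with $s_{i}^{2}=1$ for all $i\in I$; (iv) for any $n_{i}\in N$ such that $s_{i}=n_{i}H$, $n_{i}Bn_{i}\neq B$; (v) $n_{i}Bn\subseteq Bn_{i}nB\cup BnB$ for all $n\in N$ and all $n_{i}\in N$ such that $s_{i}=n_{i}H$. The length $l(w)$ of $w\in W$ is the minimal length of an expression for $w$ as a product of the $s_i$ (with $l(1_W)=0$). If $W$ is finite there is a unique element $w_{0}\in W$ such that $l(w_{0})>l(w)$ for all $w\in W$, $w\neq w_{0}$. Products of subsets are setwise, $(Bn_0B)^2=(Bn_0B)(Bn_0B)$, and $B^{n_0}=n_0^{-1}Bn_0$. *)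

theory Defs
  imports "HOL-Algebra.Algebra"
begin

text \<open>
  Cosets in \<open>Mod\<close> are right cosets; since \<open>B \<inter> N\<close> is normal in \<open>N\<close> they agree with the left
  cosets \<open>n <# (B \<inter> N)\<close> by which elements of the Weyl group are represented below.
\<close>

definition weyl_group :: "('a, 'b) monoid_scheme \<Rightarrow> 'a set \<Rightarrow> 'a set \<Rightarrow> 'a set monoid" where
  "weyl_group G B N = (G\<lparr>carrier := N\<rparr>) Mod (B \<inter> N)"

locale bn_pair = group G for G (structure) +
  fixes B N :: "'a set" and I :: "'i set" and s :: "'i \<Rightarrow> 'a set"
  assumes subgroup_B: "subgroup B G"
    and subgroup_N: "subgroup N G"
    and generate_BN: "generate G (B \<union> N) = carrier G"
    and normal_H: "(B \<inter> N) \<lhd> (G\<lparr>carrier := N\<rparr>)"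
    and s_closed: "\<And>i. i \<in> I \<Longrightarrow> s i \<in> carrier (weyl_group G B N)"
    and generate_s: "generate (weyl_group G B N) (s ` I) = carrier (weyl_group G B N)"
    and s_square: "\<And>i. i \<in> I \<Longrightarrow> s i \<otimes>\<^bsub>weyl_group G B N\<^esub> s i = \<one>\<^bsub>weyl_group G B N\<^esub>"
    and not_normalized:
      "\<And>i n\<^sub>i. \<lbrakk>i \<in> I; n\<^sub>i \<in> N; s i = n\<^sub>i <# (B \<inter> N)\<rbrakk> \<Longrightarrow> n\<^sub>i <# B #> n\<^sub>i \<noteq> B"
    and exchange:
      "\<And>i n\<^sub>i n. \<lbrakk>i \<in> I; n\<^sub>i \<in> N; s i = n\<^sub>i <# (B \<inter> N); n \<in> N\<rbrakk> \<Longrightarrow>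
         n\<^sub>i <# B #> n \<subseteq> (B #> (n\<^sub>i \<otimes> n) <#> B) \<union> (B #> n <#> B)"

text \<open>
  Words need no inverses of generators, as the generators in question are involutions.  On elements
  that are not products of elements of \<open>S\<close> the value is unspecified.
\<close>

definition word_length :: "('a, 'b) monoid_scheme \<Rightarrow> 'a set \<Rightarrow> 'a \<Rightarrow> nat" where
  "word_length W S w =
     (LEAST k. \<exists>ws. set ws \<subseteq> S \<and> length ws = k \<and> foldr (\<otimes>\<^bsub>W\<^esub>) ws \<one>\<^bsub>W\<^esub> = w)"

definition is_longest :: "('a, 'b) monoid_scheme \<Rightarrow> 'a set \<Rightarrow> 'a \<Rightarrow> bool" where
  "is_longest W S w\<^sub>0 \<longleftrightarrow> w\<^sub>0 \<in> carrier W \<and>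
     (\<forall>w \<in> carrier W. w \<noteq> w\<^sub>0 \<longrightarrow> word_length W S w\<^sub>0 > word_length W S w)"

end

theory Submission
  imports Defs
begin

text \<open>
  If \<open>l (r v) \<ge> l v\<close> then \<open>BrBvB = BrvB\<close>, and if \<open>l (r n) < l n\<close> then \<open>BnB \<subseteq> BrBnB\<close>, because
  \<open>BrBrB\<close> contains \<open>BrB\<close>. Every generator shortens the longest element \<open>n\<close> from the left, so
  applying this along a reduced expression of \<open>v\<inverse>\<close> gives \<open>BnB \<subseteq> Bv\<inverse>BnB\<close> for every \<open>v \<in> N\<close>,
  that is \<open>v \<in> BnBn\<inverse>B\<close>. With \<open>G = BNB\<close> and \<open>n\<inverse>H = nH\<close>, which holds since inversion preserves
  length, both equations follow.
\<close>

context bn_pair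
begin

section \<open>The Weyl group through representatives in \<open>N\<close>\<close>

abbreviation H :: "'a set" where "H \<equiv> B \<inter> N"

abbreviation W :: "'a set monoid" where "W \<equiv> weyl_group G B N"

definition D :: "'a \<Rightarrow> 'a set" where "D n \<equiv> B #> n <#> B"

text \<open>Collecting all representatives of all generators gives a union of cosets of
  \<open>H\<close>, so later arguments need neither an index \<open>i\<close> nor a choice of
  representative.\<close>

definition R :: "'a set" where "R = {n \<in> N. \<exists>i\<in>I. s i = n <# H}"

lemma B_carrier [simp]: "b \<in> B \<Longrightarrow> b \<in> carrier G"
  using subgroup.mem_carrier[OF subgroup_B] .

lemma N_carrier [simp]: "n \<in> N \<Longrightarrow> n \<in> carrier G"
  using subgroup.mem_carrier[OF subgroup_N] .

lemma B_closed [simp]: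
  "\<one> \<in> B" "b \<in> B \<Longrightarrow> inv b \<in> B" "\<lbrakk>b \<in> B; c \<in> B\<rbrakk> \<Longrightarrow> b \<otimes> c \<in> B"
  using subgroup_B by (auto simp: subgroup_def subgroup.m_inv_closed)

lemma N_closed [simp]:
  "\<one> \<in> N" "b \<in> N \<Longrightarrow> inv b \<in> N" "\<lbrakk>b \<in> N; c \<in> N\<rbrakk> \<Longrightarrow> b \<otimes> c \<in> N"
  using subgroup_N by (auto simp: subgroup_def subgroup.m_inv_closed)

lemma inv_cancel [simp]:
  assumes "x \<in> carrier G" "y \<in> carrier G"
  shows "inv x \<otimes> (x \<otimes> y) = y" "x \<otimes> (inv x \<otimes> y) = y"
  using assms by (simp_all flip: m_assoc)

lemma H_conj: "\<lbrakk>n \<in> N; h \<in> H\<rbrakk> \<Longrightarrow> n \<otimes> h \<otimes> inv n \<in> H"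
  using normal.inv_op_closed2[OF normal_H, of n h] m_inv_consistent[OF subgroup_N, of n] by simp

lemma H_conj': "\<lbrakk>n \<in> N; h \<in> H\<rbrakk> \<Longrightarrow> inv n \<otimes> h \<otimes> n \<in> H"
  using H_conj[of "inv n" h] by simp

lemma mem_l_coset: "x \<in> n <# H \<longleftrightarrow> (\<exists>h\<in>H. x = n \<otimes> h)"
  by (auto simp: l_coset_def)

text \<open>This is the bridge from \<open>W\<close> to \<open>G\<close>: equality of Weyl group
  elements becomes membership in \<open>H\<close>, the form used in most computations below.\<close>

lemma l_coset_eq_iff:
  assumes "n \<in> N" "m \<in> N"
  shows "n <# H = m <# H \<longleftrightarrow> inv n \<otimes> m \<in> H"
proof
  assume "n <# H = m <# H"
  moreover have "m \<in> m <# H" using assms by (auto simp: l_coset_def intro!: bexI[of _ \<one>])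
  ultimately obtain h where "h \<in> H" "m = n \<otimes> h" by (metis mem_l_coset)
  then show "inv n \<otimes> m \<in> H" using assms by auto
next
  assume h: "inv n \<otimes> m \<in> H"
  define h where "h = inv n \<otimes> m"
  have hH: "h \<in> B" "h \<in> N" and m: "m = n \<otimes> h" and n: "n = m \<otimes> inv h"
    using h assms by (auto simp: h_def inv_mult_group)
  have "n \<otimes> k \<in> m <# H" if "k \<in> H" for k
    using that hH assms by (auto simp: mem_l_coset n m_assoc intro!: bexI[of _ "inv h \<otimes> k"])
  moreover have "m \<otimes> k \<in> n <# H" if "k \<in> H" for k
    using that hH assms by (auto simp: mem_l_coset m m_assoc intro!: bexI[of _ "h \<otimes> k"])
  ultimately show "n <# H = m <# H" by (auto simp: mem_l_coset)
qed

lemma r_coset_H: "n \<in> N \<Longrightarrow> H #> n = n <# H"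
  using normal.coset_eq[OF normal_H] by (simp add: l_coset_def r_coset_def)

lemma carrier_W: "carrier W = (\<lambda>n. n <# H) ` N"
  by (auto simp: weyl_group_def FactGroup_def RCOSETS_def r_coset_H)

lemma mult_W: "\<lbrakk>n \<in> N; m \<in> N\<rbrakk> \<Longrightarrow> (n <# H) \<otimes>\<^bsub>W\<^esub> (m <# H) = (n \<otimes> m) <# H"
  using normal.rcos_sum[OF normal_H, of n m] by (simp add: weyl_group_def FactGroup_def r_coset_H)

lemma one_l_coset: "\<one> <# H = H"
  by (force simp: l_coset_def)

lemma one_W: "\<one>\<^bsub>W\<^esub> = H"
  by (simp add: weyl_group_def FactGroup_def)

lemma group_W: "group W"
  unfolding weyl_group_def by (rule normal.factorgroup_is_group[OF normal_H])

section \<open>Representatives of the generators\<close>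

lemma R_N [simp]: "r \<in> R \<Longrightarrow> r \<in> N"
  by (simp add: R_def)

lemma s_rep:
  assumes "i \<in> I"
  obtains r where "r \<in> R" "s i = r <# H"
proof -
  obtain r where "r \<in> N" "s i = r <# H" using s_closed[OF assms] unfolding carrier_W by blast
  with assms that show thesis unfolding R_def by blast
qed

lemma R_coset:
  assumes "r \<in> R" "n \<in> N" "inv r \<otimes> n \<in> H"
  shows "n \<in> R"
proof -
  obtain i where "i \<in> I" "s i = r <# H" "r \<in> N" using assms(1) unfolding R_def by blast
  then have "s i = n <# H" using assms(2,3) l_coset_eq_iff[of r n] by blast
  then show ?thesis using \<open>i \<in> I\<close> assms(2) unfolding R_def by blast
qed

lemma R_square: "r \<in> R \<Longrightarrow> r \<otimes> r \<in> H"
proof -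
  assume r: "r \<in> R"
  then obtain i where i: "i \<in> I" "s i = r <# H" unfolding R_def by blast
  from s_square[OF i(1)] have "\<one> <# H = (r \<otimes> r) <# H"
    using r by (simp add: i(2) mult_W one_W one_l_coset)
  then show ?thesis using r by (simp add: l_coset_eq_iff del: Int_iff)
qed

text \<open>As \<open>r \<otimes> r\<close> lies in \<open>H\<close>, passing from \<open>r\<close>
  to \<open>inv r\<close> stays in one coset: both represent the same generator.\<close>

lemma R_inv [simp]:
  assumes "r \<in> R" shows "inv r \<in> R"
proof (rule R_coset[OF assms])
  show "inv r \<otimes> inv r \<in> H"
    using R_square[OF assms] assms by (simp flip: inv_mult_group)
qed (use assms in simp)

lemma R_mult_H_left: "\<lbrakk>r \<in> R; h \<in> H\<rbrakk> \<Longrightarrow> h \<otimes> r \<in> R"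
  by (rule R_coset[of r]) (use H_conj'[of r h] in \<open>auto simp: m_assoc\<close>)

section \<open>Double cosets of \<open>B\<close>\<close>

lemma mem_D: "x \<in> D n \<longleftrightarrow> (\<exists>b\<in>B. \<exists>c\<in>B. x = b \<otimes> n \<otimes> c)"
  by (auto simp: D_def r_coset_def set_mult_def)

lemma D_intro: "\<lbrakk>b \<in> B; c \<in> B\<rbrakk> \<Longrightarrow> b \<otimes> n \<otimes> c \<in> D n"
  by (auto simp: mem_D)

lemma D_self [simp]: "n \<in> carrier G \<Longrightarrow> n \<in> D n"
  using D_intro[of \<one> \<one> n] by simp

lemma D_closed: "\<lbrakk>x \<in> D n; n \<in> carrier G\<rbrakk> \<Longrightarrow> x \<in> carrier G"
  by (auto simp: mem_D)

text \<open>Together with \<open>D_self\<close> and \<open>D_sym\<close>, this makes membership in a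
  double coset an equivalence relation, which replaces explicit equalities of sets
  \<open>BnB\<close>.\<close>

lemma D_trans:
  assumes "x \<in> D y" "y \<in> D z" "z \<in> carrier G" shows "x \<in> D z"
proof -
  obtain b c b' c' where "b \<in> B" "c \<in> B" "b' \<in> B" "c' \<in> B" "x = b \<otimes> (b' \<otimes> z \<otimes> c') \<otimes> c"
    using assms by (auto simp: mem_D)
  then show ?thesis using assms D_intro[of "b \<otimes> b'" "c' \<otimes> c" z] by (simp add: m_assoc)
qed

lemma D_sym:
  assumes "x \<in> D y" "y \<in> carrier G" shows "y \<in> D x"
proof -
  obtain b c where "b \<in> B" "c \<in> B" "x = b \<otimes> y \<otimes> c"
    using assms by (auto simp: mem_D)
  then show ?thesis using assms D_intro[of "inv b" "inv c" x] by (simp add: m_assoc)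
qed

lemma D_mult_iff:
  assumes "b \<in> B" "c \<in> B" "x \<in> carrier G" "n \<in> carrier G"
  shows "b \<otimes> x \<otimes> c \<in> D n \<longleftrightarrow> x \<in> D n"
  using assms D_intro[of b c x] D_sym D_trans by meson

lemma D_mult_left:
  assumes "b \<in> B" "x \<in> carrier G" "n \<in> carrier G"
  shows "b \<otimes> x \<in> D n \<longleftrightarrow> x \<in> D n"
  using D_mult_iff[of b \<one> x n] assms by simp

lemma D_mult_right:
  assumes "c \<in> B" "x \<in> carrier G" "n \<in> carrier G"
  shows "x \<otimes> c \<in> D n \<longleftrightarrow> x \<in> D n"
  using D_mult_iff[of \<one> c x n] assms by simp

lemma D_inv:
  assumes "x \<in> D n" "n \<in> carrier G" shows "inv x \<in> D (inv n)"
proof -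
  obtain b c where "b \<in> B" "c \<in> B" "x = b \<otimes> n \<otimes> c"
    using assms by (auto simp: mem_D)
  then show ?thesis using assms D_intro[of "inv c" "inv b" "inv n"] by (simp add: m_assoc inv_mult_group)
qed

section \<open>The exchange axiom for elements and its consequences for generators\<close>

lemma exchange_left:
  assumes "r \<in> R" "n \<in> N" "b \<in> B"
  shows "r \<otimes> b \<otimes> n \<in> D (r \<otimes> n) \<or> r \<otimes> b \<otimes> n \<in> D n"
proof -
  have "r \<otimes> b \<otimes> n \<in> r <# B #> n"
    using assms by (auto simp: l_coset_def r_coset_def)
  moreover obtain i where "i \<in> I" "s i = r <# H" using assms(1) unfolding R_def by blast
  then have "r <# B #> n \<subseteq> D (r \<otimes> n) \<union> D n" using assms(1,2) exchange by (simp add: D_def)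
  ultimately show ?thesis by blast
qed

text \<open>Inversion turns \<open>n \<otimes> b \<otimes> r\<close> into a product with the
  generator on the left and maps each double coset to that of the inverse.\<close>

lemma exchange_right:
  assumes "r \<in> R" "n \<in> N" "b \<in> B"
  shows "n \<otimes> b \<otimes> r \<in> D (n \<otimes> r) \<or> n \<otimes> b \<otimes> r \<in> D n"
  using exchange_left[of "inv r" "inv n" "inv b"] assms
    D_inv[of "inv r \<otimes> inv b \<otimes> inv n" "inv r \<otimes> inv n"] D_inv[of "inv r \<otimes> inv b \<otimes> inv n" "inv n"]
  by (auto simp: inv_mult_group m_assoc)

text \<open>Otherwise \<open>r\<close> conjugates \<open>B\<close> into itself. Since the square of
  \<open>r\<close> lies in \<open>B\<close>, this forces \<open>rBr = B\<close>, against
  \<open>not_normalized\<close>.\<close>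

lemma R_conj_not_B:
  assumes r: "r \<in> R"
  obtains b where "b \<in> B" "r \<otimes> b \<otimes> inv r \<notin> B"
proof (rule ccontr)
  assume "\<not> thesis"
  with that have conj: "r \<otimes> b \<otimes> inv r \<in> B" if "b \<in> B" for b using \<open>b \<in> B\<close> by blast
  have sq: "r \<otimes> r \<in> B" "inv r \<otimes> inv r \<in> B"
    using R_square[OF r] R_square[OF R_inv[OF r]] by auto
  have "r \<otimes> b \<otimes> r \<in> B" if b: "b \<in> B" for b
  proof -
    have "r \<otimes> b \<otimes> r = (r \<otimes> b \<otimes> inv r) \<otimes> (r \<otimes> r)" using r b by (simp add: m_assoc)
    then show ?thesis using conj[OF b] sq by simp
  qed
  moreover have "b \<in> r <# B #> r" if b: "b \<in> B" for b
  proof -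
    \<comment> \<open>This is the solution \<open>inv r \<otimes> b \<otimes> inv r\<close> of
      \<open>b = r \<otimes> ?c \<otimes> r\<close>, written as a product of two elements known to
      lie in \<open>B\<close>.\<close>
    let ?c = "inv r \<otimes> inv r \<otimes> (r \<otimes> b \<otimes> inv r)"
    have "?c \<in> B" using conj[OF b] sq by simp
    moreover have "b = r \<otimes> ?c \<otimes> r" using r b by (simp add: m_assoc)
    ultimately show ?thesis by (auto simp: l_coset_def r_coset_def)
  qed
  ultimately have "r <# B #> r = B" by (auto simp: l_coset_def r_coset_def)
  moreover obtain i where "i \<in> I" "s i = r <# H" using r unfolding R_def by blast
  ultimately show False using not_normalized R_N[OF r] by blast
qed

text \<open>An element of \<open>H\<close> lies in \<open>B\<close> and so would conjugate
  \<open>B\<close> into itself. Hence no generator is trivial in \<open>W\<close>.\<close>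

lemma R_not_H: "r \<in> R \<Longrightarrow> r \<notin> H"
  by (metis B_closed(2,3) IntD1 R_conj_not_B)

section \<open>Words and the length function\<close>

text \<open>These are words, not necessarily reduced, lifted to \<open>N\<close>. The trailing
  factor from \<open>H\<close> absorbs the choice of representatives, by normality of
  \<open>H\<close>.\<close>

inductive expr :: "nat \<Rightarrow> 'a \<Rightarrow> bool" where
  expr_H: "h \<in> H \<Longrightarrow> expr 0 h"
| expr_step: "\<lbrakk>r \<in> R; expr k n\<rbrakk> \<Longrightarrow> expr (Suc k) (r \<otimes> n)"

lemma expr_N [simp]: "expr k n \<Longrightarrow> n \<in> N"
  by (induction rule: expr.induct) auto

lemma expr_mult_H:
  assumes "expr k n" "h \<in> H" shows "expr k (n \<otimes> h)"
  using assms
proof (induction rule: expr.induct)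
  case (expr_step r k n)
  then show ?case using expr.expr_step[of r k "n \<otimes> h"] by (simp add: m_assoc)
qed (auto intro: expr.expr_H)

lemma expr_coset:
  assumes "expr k n" "m \<in> N" "inv n \<otimes> m \<in> H" shows "expr k m"
  using expr_mult_H[OF assms(1,3)] assms(1,2) by simp

lemma expr_mult:
  assumes "expr k n" "expr l m" shows "\<exists>j. expr j (n \<otimes> m)"
  using assms
proof (induction rule: expr.induct)
  case (expr_H h)
  have "inv m \<otimes> (h \<otimes> m) \<in> H" using H_conj'[of m h] expr_H by (auto simp: m_assoc)
  then show ?case using expr_coset[of l m "h \<otimes> m"] expr_H by auto
next
  case (expr_step r k n)
  then show ?case using expr.expr_step by (metis N_carrier R_N expr_N m_assoc)
qed

text \<open>The trailing factor \<open>h\<close> stands in the way of the new letter, but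
  \<open>h \<otimes> r\<close> is again in \<open>R\<close>, so the letter swallows it.\<close>

lemma expr_step_right:
  assumes "expr k n" "r \<in> R" shows "expr (Suc k) (n \<otimes> r)"
  using assms
proof (induction rule: expr.induct)
  case (expr_H h)
  then show ?case
    using expr.expr_step[OF R_mult_H_left[of r h] expr.expr_H[of \<one>]] by simp
next
  case (expr_step q k n)
  then show ?case using expr.expr_step[of q "Suc k" "n \<otimes> r"] by (simp add: m_assoc)
qed

lemma expr_inv: "expr k n \<Longrightarrow> expr k (inv n)"
proof (induction rule: expr.induct)
  case (expr_step r k n)
  then show ?case using expr_step_right[of k "inv n" "inv r"] by (simp add: inv_mult_group)
qed (auto intro: expr.expr_H)

text \<open>The definition only exposes the first letter. Inverting, splitting that off and
  inverting back exposes the last one.\<close>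

lemma expr_Suc_right:
  assumes "expr (Suc k) n"
  obtains m r where "expr k m" "r \<in> R" "n = m \<otimes> r"
proof -
  have "expr (Suc k) (inv n)" using assms by (rule expr_inv)
  then obtain r m where rm: "inv n = r \<otimes> m" "r \<in> R" "expr k m" by (cases rule: expr.cases) auto
  then have "n = inv m \<otimes> inv r" using assms by (metis N_carrier R_N expr_N inv_inv inv_mult_group)
  then show thesis using that[OF expr_inv[OF rm(3)] R_inv[OF rm(2)]] by blast
qed

lemma expr_iff_word:
  assumes "n \<in> N"
  shows "expr k n \<longleftrightarrow>
    (\<exists>ws. set ws \<subseteq> s ` I \<and> length ws = k \<and> foldr (\<otimes>\<^bsub>W\<^esub>) ws \<one>\<^bsub>W\<^esub> = n <# H)"
proof
  assume "expr k n"
  then show "\<exists>ws. set ws \<subseteq> s ` I \<and> length ws = k \<and> foldr (\<otimes>\<^bsub>W\<^esub>) ws \<one>\<^bsub>W\<^esub> = n <# H"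
  proof (induction rule: expr.induct)
    case (expr_H h)
    then show ?case using l_coset_eq_iff[of \<one> h] by (auto simp: one_W one_l_coset)
  next
    case (expr_step r k n)
    then obtain ws where ws: "set ws \<subseteq> s ` I" "length ws = k" "foldr (\<otimes>\<^bsub>W\<^esub>) ws \<one>\<^bsub>W\<^esub> = n <# H"
      by blast
    obtain i where "i \<in> I" "s i = r <# H" using \<open>r \<in> R\<close> unfolding R_def by blast
    with ws expr_step show ?case by (intro exI[of _ "s i # ws"]) (auto simp: mult_W)
  qed
next
  assume "\<exists>ws. set ws \<subseteq> s ` I \<and> length ws = k \<and> foldr (\<otimes>\<^bsub>W\<^esub>) ws \<one>\<^bsub>W\<^esub> = n <# H"
  then obtain ws where "set ws \<subseteq> s ` I" "length ws = k" "foldr (\<otimes>\<^bsub>W\<^esub>) ws \<one>\<^bsub>W\<^esub> = n <# H"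
    by blast
  then show "expr k n" using assms
  proof (induction ws arbitrary: k n)
    case Nil
    then show ?case using l_coset_eq_iff[of \<one> n] by (auto simp: one_W one_l_coset intro: expr.expr_H)
  next
    case (Cons w ws)
    obtain r where r: "r \<in> R" "w = r <# H" using Cons.prems(1) by (auto elim: s_rep)
    \<comment> \<open>The value of the tail must lie in \<open>W\<close> to have a representative
      \<open>m\<close> in \<open>N\<close> for the induction hypothesis.\<close>
    have "foldr (\<otimes>\<^bsub>W\<^esub>) us \<one>\<^bsub>W\<^esub> \<in> carrier W" if "set us \<subseteq> s ` I" for us
      using that s_closed group_W
      by (induction us) (auto intro!: monoid.m_closed monoid.one_closed group.is_monoid)
    then obtain m where m: "m \<in> N" "foldr (\<otimes>\<^bsub>W\<^esub>) ws \<one>\<^bsub>W\<^esub> = m <# H"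
      using Cons.prems(1) by (force simp: carrier_W)
    have "expr (length ws) m" using Cons.IH[of _ m] Cons.prems m by simp
    moreover have "(r \<otimes> m) <# H = n <# H" using Cons.prems(3) m r by (simp add: mult_W)
    ultimately show ?case
      using expr_coset[OF expr.expr_step[of r "length ws" m]] Cons.prems m r
      by (auto simp: l_coset_eq_iff)
  qed
qed

definition len :: "'a \<Rightarrow> nat" where "len n = (LEAST k. expr k n)"

text \<open>Both sides are \<open>LEAST\<close> of equivalent predicates, so no word need be known
  to exist at this point.\<close>

lemma word_length_eq_len: "n \<in> N \<Longrightarrow> word_length W (s ` I) (n <# H) = len n"
  by (simp add: word_length_def len_def expr_iff_word)

text \<open>Induction over the generated subgroup. Inverses of generators add nothing new, because
  the generators are involutions.\<close>

lemma expr_exists: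
  assumes "n \<in> N" shows "\<exists>k. expr k n"
proof -
  have "\<exists>m k. w = m <# H \<and> expr k m" if "w \<in> generate W (s ` I)" for w
    using that
  proof (induction rule: generate.induct)
    case one
    then show ?case using expr.expr_H[of \<one>] by (auto simp: one_W intro!: exI[of _ \<one>] simp: one_l_coset)
  next
    case (incl w)
    then obtain r where "r \<in> R" "w = r <# H" by (auto elim: s_rep)
    then show ?case using expr.expr_step[of r, OF _ expr.expr_H[of \<one>]] by auto
  next
    case (inv w)
    then obtain i where i: "i \<in> I" "w = s i" by auto
    then have "inv\<^bsub>W\<^esub> w = w"
      using s_square s_closed group.inv_equality[OF group_W] by blast
    moreover obtain r where "r \<in> R" "w = r <# H" using i by (auto elim: s_rep)
    ultimately show ?case using expr.expr_step[of r, OF _ expr.expr_H[of \<one>]] by auto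
  next
    case (eng w v)
    then obtain m k p l where "w = m <# H" "expr k m" "v = p <# H" "expr l p" by blast
    then show ?case using expr_mult[of k m l p] by (auto simp: mult_W intro!: exI[of _ "m \<otimes> p"])
  qed
  then obtain m k where "n <# H = m <# H" "expr k m"
    using assms generate_s by (metis carrier_W imageI)
  then show ?thesis using assms expr_coset[of k m n] by (metis expr_N l_coset_eq_iff)
qed

lemma expr_len: "n \<in> N \<Longrightarrow> expr (len n) n"
  unfolding len_def by (rule LeastI_ex[OF expr_exists])

lemma len_le: "expr k n \<Longrightarrow> len n \<le> k"
  unfolding len_def by (rule Least_le)

lemma len_coset: "\<lbrakk>n \<in> N; m \<in> N; inv n \<otimes> m \<in> H\<rbrakk> \<Longrightarrow> len n = len m"
  using word_length_eq_len l_coset_eq_iff by metis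

lemma len_inv: "n \<in> N \<Longrightarrow> len (inv n) = len n"
  using len_le[OF expr_inv[OF expr_len, of n]] len_le[OF expr_inv[OF expr_len, of "inv n"]] by simp

lemma len_mult_R_le: "\<lbrakk>r \<in> R; n \<in> N\<rbrakk> \<Longrightarrow> len (r \<otimes> n) \<le> Suc (len n)"
  using len_le[OF expr_step] expr_len by simp

lemma len_le_mult_R: "\<lbrakk>r \<in> R; n \<in> N\<rbrakk> \<Longrightarrow> len n \<le> Suc (len (r \<otimes> n))"
  using len_mult_R_le[of "inv r" "r \<otimes> n"] by simp

lemma len_mult_R_right_le: "\<lbrakk>r \<in> R; n \<in> N\<rbrakk> \<Longrightarrow> len (n \<otimes> r) \<le> Suc (len n)"
  using len_le[OF expr_step_right] expr_len by simp

section \<open>Distinct elements of \<open>W\<close> have distinct double cosets\<close>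

text \<open>The induction is asymmetric in \<open>n\<close> and \<open>m\<close>: only \<open>n\<close> is peeled, and the length of \<open>m\<close> may drop by one.\<close>

lemma D_inj_aux:
  assumes "expr k n" "m \<in> N" "k \<le> len m" "m \<in> D n"
  shows "inv n \<otimes> m \<in> H"
  using assms
proof (induction arbitrary: m rule: expr.induct)
  case (expr_H h)
  \<comment> \<open>Here \<open>h\<close> lies in \<open>B\<close>, so its double coset is
    \<open>B\<close> itself.\<close>
  then have "m \<in> B" by (auto simp: mem_D)
  then show ?case using expr_H by auto
next
  case (expr_step r k n)
  have c: "r \<in> carrier G" "n \<in> carrier G" "m \<in> carrier G" "n \<in> N" "r \<in> N" "m \<in> N" using expr_step by auto
  obtain b d where bd: "b \<in> B" "d \<in> B" "r \<otimes> n = b \<otimes> m \<otimes> d"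
    using D_sym[OF expr_step.prems(3)] c by (auto simp: mem_D)
  have n: "n = inv r \<otimes> b \<otimes> m \<otimes> d"
  proof -
    have "n = inv r \<otimes> (r \<otimes> n)" using c by simp
    also have "\<dots> = inv r \<otimes> (b \<otimes> m \<otimes> d)" by (simp only: bd(3))
    also have "\<dots> = inv r \<otimes> b \<otimes> m \<otimes> d" using bd(1,2) c by (simp add: m_assoc)
    finally show ?thesis .
  qed
  have ex: "inv r \<otimes> b \<otimes> m \<in> D (inv r \<otimes> m) \<or> inv r \<otimes> b \<otimes> m \<in> D m"
    using exchange_left[of "inv r" m b] expr_step bd by simp
  have eq: "n \<in> D z \<longleftrightarrow> inv r \<otimes> b \<otimes> m \<in> D z" if "z \<in> carrier G" for z
    using D_mult_right[OF bd(2), of "inv r \<otimes> b \<otimes> m" z] bd(1) c that by (simp flip: n)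
  have "n \<in> D (inv r \<otimes> m) \<or> n \<in> D m"
    using ex c(1,3) by (simp add: eq)
  then show ?case
  proof
    assume "n \<in> D (inv r \<otimes> m)"
    then have "inv r \<otimes> m \<in> D n" by (rule D_sym) (use c in simp)
    moreover have "k \<le> len (inv r \<otimes> m)"
      using expr_step.prems(2) len_le_mult_R[of "inv r" m] expr_step(1) c by simp
    moreover have "inv r \<otimes> m \<in> N" using c by simp
    ultimately have "inv n \<otimes> (inv r \<otimes> m) \<in> H" using expr_step.IH[of "inv r \<otimes> m"] by simp
    then show ?thesis using c by (simp add: inv_mult_group m_assoc)
  next
    assume "n \<in> D m"
    then have "m \<in> D n" by (rule D_sym) (rule c)
    then have "inv n \<otimes> m \<in> H" using c expr_step.IH[of m] expr_step.prems(2) by simp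
    \<comment> \<open>The second alternative of the exchange is impossible: \<open>m\<close> would
      inherit a word of length \<open>k\<close>, while its length is at least
      \<open>Suc k\<close>.\<close>
    then have "expr k m" by (rule expr_coset[OF expr_step.hyps(2) \<open>m \<in> N\<close>])
    then have "len m \<le> k" by (rule len_le)
    then show ?thesis using expr_step.prems(2) by simp
  qed
qed

text \<open>The uniqueness half of the Bruhat decomposition: peel whichever of the two elements is
  not longer than the other.\<close>

lemma D_inj:
  assumes "n \<in> N" "m \<in> N" "m \<in> D n"
  shows "inv n \<otimes> m \<in> H"
proof (cases "len n \<le> len m")
  case True
  then show ?thesis using D_inj_aux[OF expr_len] assms by blast
next
  case False
  then have "inv m \<otimes> n \<in> H"
    using D_inj_aux[OF expr_len, of m n] D_sym[of m n] assms by simp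
  then have "inv (inv m \<otimes> n) \<in> H" by simp
  then show ?thesis using assms by (simp add: inv_mult_group)
qed

section \<open>Products of double cosets and length\<close>

text \<open>Split off the last letter \<open>t\<close> of \<open>n\<close>, leaving
  \<open>m\<close>. If the claim fails, the exchange axiom on both sides puts
  \<open>r \<otimes> b \<otimes> m\<close> in the double coset of \<open>m\<close> or of
  \<open>n\<close>. By induction it is also in that of \<open>r \<otimes> m\<close>, and
  \<open>D_inj\<close> makes both cases absurd.\<close>

lemma D_mult_ascent:
  assumes "expr k n" "len n = k" "r \<in> R" "k \<le> len (r \<otimes> n)" "b \<in> B"
  shows "r \<otimes> b \<otimes> n \<in> D (r \<otimes> n)"
  using assms
proof (induction k arbitrary: n b)
  case 0
  then have n: "n \<in> H" by (cases rule: expr.cases) auto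
  have "r \<otimes> b \<otimes> n = \<one> \<otimes> (r \<otimes> n) \<otimes> (inv n \<otimes> b \<otimes> n)"
    using n 0 by (simp add: m_assoc)
  also have "\<dots> \<in> D (r \<otimes> n)" using n 0 by (intro D_intro) auto
  finally show ?case .
next
  case (Suc k)
  obtain m t where mt: "expr k m" "t \<in> R" "n = m \<otimes> t"
    using expr_Suc_right[OF Suc.prems(1)] by blast
  have c: "m \<in> N" "t \<in> N" "r \<in> N" "n \<in> N" "m \<in> carrier G" "t \<in> carrier G" "r \<in> carrier G"
    "b \<in> carrier G" "n \<in> carrier G"
    using mt Suc.prems by auto
  have lm: "len m = k"
    using len_le[OF mt(1)] len_mult_R_right_le[of t m] mt c Suc.prems(2) by simp
  \<comment> \<open>Removing \<open>t\<close> costs at most one, so \<open>r\<close> does not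
    shorten \<open>m\<close> either, as the induction hypothesis requires.\<close>
  have "len (r \<otimes> n) \<le> Suc (len (r \<otimes> m))"
    using len_mult_R_right_le[of t "r \<otimes> m"] mt c by (simp add: m_assoc)
  then have IH: "r \<otimes> b \<otimes> m \<in> D (r \<otimes> m)"
    using Suc lm mt by simp
  show ?case
  proof (rule ccontr)
    assume "r \<otimes> b \<otimes> n \<notin> D (r \<otimes> n)"
    then have "r \<otimes> b \<otimes> n \<in> D n" using exchange_left Suc.prems c by blast
    then obtain x y where xy: "x \<in> B" "y \<in> B" "r \<otimes> b \<otimes> n = x \<otimes> n \<otimes> y" by (auto simp: mem_D)
    have "r \<otimes> b \<otimes> m = r \<otimes> b \<otimes> n \<otimes> inv t" using c mt by (simp add: m_assoc)
    also have "\<dots> = x \<otimes> (n \<otimes> y \<otimes> inv t)" using c xy by (simp add: m_assoc)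
    finally have eq: "r \<otimes> b \<otimes> m = x \<otimes> (n \<otimes> y \<otimes> inv t)" .
    have m: "n \<otimes> inv t = m" using c mt by (simp add: m_assoc)
    have "n \<otimes> y \<otimes> inv t \<in> D m \<or> n \<otimes> y \<otimes> inv t \<in> D n"
      using exchange_right[of "inv t" n y] xy c mt(2) m by simp
    then have "r \<otimes> b \<otimes> m \<in> D m \<or> r \<otimes> b \<otimes> m \<in> D n"
      using xy c by (simp add: eq D_mult_left)
    then have "r \<otimes> m \<in> D m \<or> r \<otimes> m \<in> D n"
      using D_sym[OF IH] D_trans c by (meson N_closed(3) N_carrier)
    then show False
    proof
      assume "r \<otimes> m \<in> D m"
      then have "inv m \<otimes> (r \<otimes> m) \<in> H" using c by (intro D_inj) auto
      then have "m \<otimes> (inv m \<otimes> (r \<otimes> m)) \<otimes> inv m \<in> H" using H_conj c by blast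
      then show False using R_not_H[OF Suc.prems(3)] c by (simp add: m_assoc)
    next
      assume "r \<otimes> m \<in> D n"
      \<comment> \<open>If \<open>r \<otimes> m\<close> and \<open>n\<close> agree modulo
        \<open>H\<close>, then \<open>r \<otimes> n\<close> agrees with \<open>m\<close>, since
        \<open>r\<close> squares into \<open>H\<close>; its length is then \<open>k\<close>, below
        the assumed \<open>Suc k\<close>.\<close>
      then have h: "inv n \<otimes> (r \<otimes> m) \<in> H" using c by (intro D_inj) auto
      have "inv (r \<otimes> n) \<otimes> (r \<otimes> r \<otimes> m) = inv n \<otimes> (r \<otimes> m)"
        using c by (simp add: inv_mult_group m_assoc)
      then have "len (r \<otimes> n) = len (r \<otimes> r \<otimes> m)" using h c by (intro len_coset) auto
      also have "inv m \<otimes> (r \<otimes> r \<otimes> m) \<in> H"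
        using H_conj'[OF c(1) R_square[OF Suc.prems(3)]] c by (simp add: m_assoc)
      then have "len (r \<otimes> r \<otimes> m) = len m" using c by (intro len_coset[symmetric]) auto
      finally show False using lm Suc.prems by simp
    qed
  qed
qed

lemma D_mult_descent:
  assumes "r \<in> R" "n \<in> N" "len (r \<otimes> n) < len n"
  obtains b where "b \<in> B" "r \<otimes> b \<otimes> n \<in> D n"
proof -
  have c: "r \<in> N" "r \<in> carrier G" "n \<in> carrier G" using assms by auto
  obtain b where b: "b \<in> B" "r \<otimes> b \<otimes> inv r \<notin> B" using R_conj_not_B[OF assms(1)] by blast
  \<comment> \<open>The exchange leaves the double cosets of \<open>\<one>\<close> and of
    \<open>inv r\<close>; the first is \<open>B\<close>, which the choice of \<open>b\<close>
    excludes.\<close>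
  then have "r \<otimes> b \<otimes> inv r \<in> D (inv r)"
    using exchange_left[of r "inv r" b] c assms(1) by (auto simp: mem_D)
  then obtain x y where xy: "x \<in> B" "y \<in> B" "r \<otimes> b \<otimes> inv r = x \<otimes> inv r \<otimes> y"
    by (auto simp: mem_D)
  \<comment> \<open>Seen from the shorter element \<open>r \<otimes> n\<close>, multiplication by
    \<open>inv r\<close> is an ascent and leads back to \<open>n\<close>.\<close>
  have "inv r \<otimes> y \<otimes> (r \<otimes> n) \<in> D (inv r \<otimes> (r \<otimes> n))"
    using assms c xy by (intro D_mult_ascent[OF expr_len]) auto
  then have "x \<otimes> (inv r \<otimes> y \<otimes> (r \<otimes> n)) \<in> D n"
    using c xy by (simp add: D_mult_left)
  moreover have "r \<otimes> b \<otimes> n = (r \<otimes> b \<otimes> inv r) \<otimes> (r \<otimes> n)"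
    using b c by (simp add: m_assoc)
  ultimately show thesis using that b c xy by (simp add: m_assoc)
qed

text \<open>The letters of a reduced word for \<open>v\<close> are absorbed into \<open>BnB\<close>
  one at a time. Reducedness makes each new letter an ascent on the part of \<open>v\<close> already
  built, so that part and the letter merge into one double coset.\<close>

lemma D_absorb:
  assumes "n \<in> N" "\<And>r. r \<in> R \<Longrightarrow> len (r \<otimes> n) < len n" "expr k v" "len v = k"
  shows "\<exists>b\<in>B. v \<otimes> b \<otimes> n \<in> D n"
  using assms(3,4)
proof (induction rule: expr.induct)
  case (expr_H h)
  then show ?case using assms(1) by (intro bexI[of _ \<one>]) (auto simp: D_mult_left)
next
  case (expr_step r k v)
  have c: "r \<in> N" "v \<in> N" "r \<in> carrier G" "v \<in> carrier G" "n \<in> carrier G"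
    using expr_step assms by auto
  have lv: "len v = k"
    using len_le[OF expr_step(2)] len_mult_R_le[OF expr_step(1) c(2)] expr_step.prems by simp
  obtain e where e: "e \<in> B" "v \<otimes> e \<otimes> n \<in> D n" using expr_step.IH lv by blast
  \<comment> \<open>The induction hypothesis is read backwards, to replace \<open>n\<close> in
    \<open>r \<otimes> b \<otimes> n\<close> by an expression containing \<open>v\<close>.\<close>
  obtain p q where pq: "p \<in> B" "q \<in> B" "n = p \<otimes> (v \<otimes> e \<otimes> n) \<otimes> q"
    using D_sym[OF e(2) c(5)] by (auto simp: mem_D)
  obtain b where b: "b \<in> B" "r \<otimes> b \<otimes> n \<in> D n"
    using D_mult_descent assms expr_step(1) by blast
  have "r \<otimes> (b \<otimes> p) \<otimes> v \<in> D (r \<otimes> v)"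
    using expr_step lv b pq by (intro D_mult_ascent[of k]) auto
  then obtain x y where xy: "x \<in> B" "y \<in> B" "r \<otimes> (b \<otimes> p) \<otimes> v = x \<otimes> (r \<otimes> v) \<otimes> y"
    by (auto simp: mem_D)
  have "r \<otimes> b \<otimes> n = r \<otimes> b \<otimes> (p \<otimes> (v \<otimes> e \<otimes> n) \<otimes> q)" using pq(3) by simp
  also have "\<dots> = (r \<otimes> (b \<otimes> p) \<otimes> v) \<otimes> (e \<otimes> n \<otimes> q)"
    using c e pq b by (simp add: m_assoc)
  also have "\<dots> = x \<otimes> (r \<otimes> v \<otimes> (y \<otimes> e) \<otimes> n) \<otimes> q"
    using c e pq xy by (simp add: m_assoc)
  finally have "r \<otimes> v \<otimes> (y \<otimes> e) \<otimes> n \<in> D n" using b c xy pq e by (simp add: D_mult_iff)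
  then show ?case using xy e by auto
qed

text \<open>The union \<open>U\<close> of the double cosets contains \<open>\<one>\<close> and is
  stable under left multiplication by \<open>B\<close> and, letter by letter through the exchange
  axiom, by \<open>N\<close>. As these generate \<open>G\<close>, \<open>U\<close> is
  everything.\<close>

lemma bruhat:
  assumes "g \<in> carrier G" obtains n where "n \<in> N" "g \<in> D n"
proof -
  define U where "U = (\<Union>n\<in>N. D n)"
  have UG: "x \<in> U \<Longrightarrow> x \<in> carrier G" for x by (auto simp: U_def dest: D_closed)
  have B: "b \<otimes> x \<in> U" if "b \<in> B" "x \<in> U" for b x
    using that D_mult_left[of b x] UG[OF that(2)] by (auto simp: U_def)
  have "n \<otimes> x \<in> U" if "expr k n" "x \<in> U" for k n x
    using that
  proof (induction rule: expr.induct)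
    case (expr_step r k n)
    then obtain m b d where m: "m \<in> N" "b \<in> B" "d \<in> B" "n \<otimes> x = b \<otimes> m \<otimes> d"
      by (auto simp: U_def mem_D)
    have "r \<otimes> b \<otimes> m \<otimes> d \<in> D (r \<otimes> m) \<or> r \<otimes> b \<otimes> m \<otimes> d \<in> D m"
      using exchange_left[OF expr_step(1) m(1,2)] m expr_step(1) by (simp add: D_mult_right)
    moreover have "r \<otimes> n \<otimes> x = r \<otimes> b \<otimes> m \<otimes> d"
      using m expr_step UG by (simp add: m_assoc)
    ultimately show ?case using m expr_step(1) by (auto simp: U_def)
  qed (use B in auto)
  then have N: "n \<otimes> x \<in> U" if "n \<in> N" "x \<in> U" for n x using that expr_len by blast
  have "g \<in> carrier G \<and> (\<forall>x\<in>U. g \<otimes> x \<in> U)" if "g \<in> generate G (B \<union> N)" for g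
    using that
  proof (induction rule: generate.induct)
    case (eng g h)
    then show ?case using UG by (auto simp: m_assoc)
  qed (use B N UG in auto)
  moreover have "\<one> \<in> U" using D_self[of \<one>] N_closed(1) unfolding U_def by blast
  ultimately have "g \<otimes> \<one> \<in> U" using assms generate_BN by blast
  then show thesis using that assms by (auto simp: U_def)
qed

section \<open>The longest element\<close>

lemma longest_descent:
  assumes "is_longest W (s ` I) (n <# H)" "n \<in> N" "m \<in> N" "inv n \<otimes> m \<notin> H"
  shows "len m < len n"
proof -
  have "m <# H \<noteq> n <# H" using assms(2-4) l_coset_eq_iff[of n m] by metis
  moreover have "m <# H \<in> carrier W" using assms(3) by (simp add: carrier_W)
  ultimately have "word_length W (s ` I) (m <# H) < word_length W (s ` I) (n <# H)"
    using assms(1) unfolding is_longest_def by blast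
  then show ?thesis using assms(2,3) by (simp add: word_length_eq_len)
qed

text \<open>Inversion preserves length, so by strictness of the maximum \<open>inv n\<close> lies in
  the coset of \<open>n\<close>.\<close>

lemma longest_inv:
  assumes "is_longest W (s ` I) (n <# H)" "n \<in> N"
  shows "inv n \<otimes> inv n \<in> H"
  using longest_descent[OF assms, of "inv n"] len_inv[of n] assms(2) by (auto simp del: Int_iff)

text \<open>It suffices that \<open>r \<otimes> n\<close> lies in another coset than
  \<open>n\<close>. If not, conjugating by \<open>n\<close> would put \<open>r\<close> in
  \<open>H\<close>.\<close>

lemma longest_left_descent:
  assumes "is_longest W (s ` I) (n <# H)" "n \<in> N" "r \<in> R"
  shows "len (r \<otimes> n) < len n"
proof (rule longest_descent[OF assms(1,2)])
  show "inv n \<otimes> (r \<otimes> n) \<notin> H"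
  proof
    assume "inv n \<otimes> (r \<otimes> n) \<in> H"
    then have "n \<otimes> (inv n \<otimes> (r \<otimes> n)) \<otimes> inv n \<in> H" using H_conj assms by blast
    then show False using R_not_H[OF assms(3)] assms by (simp add: m_assoc)
  qed
qed (use assms in simp)

section \<open>The two product formulas\<close>

lemma mem_set_mult_DD:
  assumes "n \<in> N" "m \<in> N"
  shows "x \<in> D n <#> D m \<longleftrightarrow> (\<exists>a\<in>B. \<exists>b\<in>B. \<exists>c\<in>B. x = a \<otimes> n \<otimes> b \<otimes> m \<otimes> c)"
proof
  assume "x \<in> D n <#> D m"
  then obtain a b b' c where "a \<in> B" "b \<in> B" "b' \<in> B" "c \<in> B" "x = (a \<otimes> n \<otimes> b) \<otimes> (b' \<otimes> m \<otimes> c)"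
    by (auto simp: set_mult_def mem_D)
  then have "x = a \<otimes> n \<otimes> (b \<otimes> b') \<otimes> m \<otimes> c" "b \<otimes> b' \<in> B"
    using assms by (simp_all add: m_assoc)
  then show "\<exists>a\<in>B. \<exists>b\<in>B. \<exists>c\<in>B. x = a \<otimes> n \<otimes> b \<otimes> m \<otimes> c" using \<open>a \<in> B\<close> \<open>c \<in> B\<close> by blast
next
  assume "\<exists>a\<in>B. \<exists>b\<in>B. \<exists>c\<in>B. x = a \<otimes> n \<otimes> b \<otimes> m \<otimes> c"
  then obtain a b c where abc: "a \<in> B" "b \<in> B" "c \<in> B" "x = a \<otimes> n \<otimes> b \<otimes> m \<otimes> c" by blast
  then have "x = (a \<otimes> n \<otimes> b) \<otimes> (\<one> \<otimes> m \<otimes> c)" using assms by (simp add: m_assoc)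
  then show "x \<in> D n <#> D m"
    using abc D_intro[of a b n] D_intro[of \<one> c m] unfolding set_mult_def by auto
qed

lemma longest_square:
  assumes "is_longest W (s ` I) (n <# H)" "n \<in> N"
  shows "carrier G = D n <#> D n" "D n <#> D n = B <#> (inv n <# B #> n) <#> B"
proof -
  \<comment> \<open>This \<open>h\<close> lies in \<open>H\<close>, hence in \<open>B\<close>. It
    trades \<open>inv n\<close> for \<open>n \<otimes> h\<close> in both equations, and a
    neighbouring factor from \<open>B\<close> then absorbs it.\<close>
  define h where "h = inv n \<otimes> inv n"
  have h: "h \<in> B" "h \<in> carrier G" "inv h \<in> B" using longest_inv[OF assms] by (auto simp: h_def)
  have inv_n: "inv n = n \<otimes> h" and n: "n = inv n \<otimes> inv h"
    using assms by (simp_all add: h_def inv_mult_group)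
  have c: "n \<in> carrier G" using assms by simp
  have DD: "x \<in> D n <#> D n \<longleftrightarrow> (\<exists>a\<in>B. \<exists>b\<in>B. \<exists>c\<in>B. x = a \<otimes> n \<otimes> b \<otimes> n \<otimes> c)" for x
    by (rule mem_set_mult_DD) fact+
  show "carrier G = D n <#> D n"
  proof
    show "D n <#> D n \<subseteq> carrier G"
      using c by (auto simp: DD)
    show "carrier G \<subseteq> D n <#> D n"
    proof
      fix g assume "g \<in> carrier G"
      then obtain v where v: "v \<in> N" "g \<in> D v" by (rule bruhat)
      \<comment> \<open>Absorbing \<open>inv v\<close> rather than \<open>v\<close> allows solving
        for \<open>v\<close>, which becomes \<open>b \<otimes> n\<close> times the inverse of an
        element of \<open>BnB\<close>.\<close>
      obtain b where b: "b \<in> B" "inv v \<otimes> b \<otimes> n \<in> D n"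
        using D_absorb[OF assms(2) longest_left_descent[OF assms] expr_len, of "inv v"] v by auto
      obtain x y where xy: "x \<in> B" "y \<in> B" "inv v \<otimes> b \<otimes> n = x \<otimes> n \<otimes> y"
        using b by (auto simp: mem_D)
      obtain p q where pq: "p \<in> B" "q \<in> B" "g = p \<otimes> v \<otimes> q" using v by (auto simp: mem_D)
      have "v = b \<otimes> n \<otimes> inv (inv v \<otimes> b \<otimes> n)"
        using v b c by (simp add: inv_mult_group m_assoc)
      also have "\<dots> = b \<otimes> n \<otimes> (inv y \<otimes> inv n \<otimes> inv x)"
        using xy c by (simp add: inv_mult_group m_assoc)
      also have "\<dots> = b \<otimes> n \<otimes> (inv y \<otimes> (n \<otimes> h) \<otimes> inv x)"
        by (simp only: inv_n)
      finally have "g = (p \<otimes> b) \<otimes> n \<otimes> inv y \<otimes> n \<otimes> (h \<otimes> inv x \<otimes> q)"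
        using pq b c xy h by (simp add: m_assoc)
      moreover have "p \<otimes> b \<in> B" "inv y \<in> B" "h \<otimes> inv x \<otimes> q \<in> B" using pq b xy h by auto
      ultimately show "g \<in> D n <#> D n" unfolding DD by blast
    qed
  qed
  have DD': "x \<in> B <#> (inv n <# B #> n) <#> B \<longleftrightarrow>
      (\<exists>a\<in>B. \<exists>b\<in>B. \<exists>c\<in>B. x = a \<otimes> (inv n \<otimes> b \<otimes> n) \<otimes> c)" for x
    by (auto simp: set_mult_def l_coset_def r_coset_def)
  show "D n <#> D n = B <#> (inv n <# B #> n) <#> B"
  proof (intro equalityI subsetI)
    fix x assume "x \<in> D n <#> D n"
    then obtain a b d where abd: "a \<in> B" "b \<in> B" "d \<in> B" "x = a \<otimes> n \<otimes> b \<otimes> n \<otimes> d"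
      by (auto simp: DD)
    then have "x = a \<otimes> (inv n \<otimes> inv h) \<otimes> b \<otimes> n \<otimes> d" using n by simp
    then have "x = a \<otimes> (inv n \<otimes> (inv h \<otimes> b) \<otimes> n) \<otimes> d" using abd c h by (simp add: m_assoc)
    moreover have "inv h \<otimes> b \<in> B" using abd h by simp
    ultimately show "x \<in> B <#> (inv n <# B #> n) <#> B" unfolding DD' using abd by blast
  next
    fix x assume "x \<in> B <#> (inv n <# B #> n) <#> B"
    then obtain a b d where abd: "a \<in> B" "b \<in> B" "d \<in> B" "x = a \<otimes> (inv n \<otimes> b \<otimes> n) \<otimes> d"
      by (auto simp: DD')
    then have "x = a \<otimes> (n \<otimes> h \<otimes> b \<otimes> n) \<otimes> d" using inv_n by simp
    then have "x = a \<otimes> n \<otimes> (h \<otimes> b) \<otimes> n \<otimes> d" using abd c h by (simp add: m_assoc)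
    moreover have "h \<otimes> b \<in> B" using abd h by simp
    ultimately show "x \<in> D n <#> D n" unfolding DD using abd by blast
  qed
qed

end

theorem theorem3:
  fixes G :: "('a, 'b) monoid_scheme" (structure)
    and B N :: "'a set" and I :: "'i set" and s :: "'i \<Rightarrow> 'a set"
    and w\<^sub>0 :: "'a set" and n\<^sub>0 :: 'a
  assumes "bn_pair G B N I s"
    and "finite (carrier (weyl_group G B N))"
    and "is_longest (weyl_group G B N) (s ` I) w\<^sub>0"
    and "n\<^sub>0 \<in> N"
    and "n\<^sub>0 <# (B \<inter> N) = w\<^sub>0"
  shows "carrier G = (B #> n\<^sub>0 <#> B) <#> (B #> n\<^sub>0 <#> B) \<and>
         (B #> n\<^sub>0 <#> B) <#> (B #> n\<^sub>0 <#> B) = B <#> (inv n\<^sub>0 <# B #> n\<^sub>0) <#> B"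
  using bn_pair.longest_square[OF assms(1)] assms by (auto simp: bn_pair.D_def[OF assms(1)])

end
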